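(* Any graph $G$ obtained from a Halin tree $T$ by isomorphic leaf matching is a minimal bipartite matching covered graph that is $2$-vertex extremal. Furthermore: (i) if $T$ is a cubic Halin tree then $G$ is also $2$-vertex $n$-extremal, whereas (ii) if $T$ is a star then $G$ is also edge extremal.
   Context: All graphs are finite and loopless; parallel edges are allowed. For a graph $G=(V,E)$ write $n=|V|$ and $m=|E|$. A connected graph on four or more vertices is matching covered if every edge lies in some perfect matching. A matching covered graph is minimal if deleting any single edge yields a graph that is not matching covered. $V_2$ denotes the set of vertices of degree two. A minimal bipartite matching covered graph is: $2$-vertex extremal if $|V_2|=2(m-n+2)$; $2$-vertex $n$-extremal if $|V_2|=\frac n2+2$; edge extremal if $|E|=\frac{3n-6}{2}$. A Halin tree is a tree on at least two vertices with no vertex of degree two, i.e. all of whose non-leaves have degree at least three ($K_2$, both of whose vertices are leaves, is the smallest Halin tree). It is cubic if all its non-leaves have degree exactly three. A star is $K_{1,p}$ with $p\geq 2$ (so a star that is a Halin tree has $p\ge 3$). A graph $H$ is obtained from a tree $T$ (on at least two vertices) by isomorphic leaf matching if, for a disjoint copy $T'$ of $T$ and some fixed isomorphism from $T$ to $T'$, $H$ is obtained from $T\cup T'$ by adding, for each leaf of $T$, one edge joining this leaf to the corresponding leaf of $T'$ under the isomorphism. *)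

theory Defs
  imports Complex_Main
begin

(* Undirected multigraphs: edges are abstract objects, so parallel edges are allowed.
   The value of ends outside edges is irrelevant. *)
record ('v, 'e) multigraph =
  verts :: "'v set"
  edges :: "'e set"
  ends :: "'e \<Rightarrow> 'v set"

definition is_graph :: "('v, 'e) multigraph \<Rightarrow> bool" where
  "is_graph G \<longleftrightarrow> finite (verts G) \<and> finite (edges G) \<and>
     (\<forall>e\<in>edges G. ends G e \<subseteq> verts G \<and> card (ends G e) = 2)"

(* Counting incident edges is correct only because graphs are loopless. *)
definition degree :: "('v, 'e) multigraph \<Rightarrow> 'v \<Rightarrow> nat" where
  "degree G v = card {e \<in> edges G. v \<in> ends G e}"

definition adjacency :: "('v, 'e) multigraph \<Rightarrow> ('v \<times> 'v) set" where
  "adjacency G = {(u, v). \<exists>e\<in>edges G. ends G e = {u, v}}"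

definition connected_graph :: "('v, 'e) multigraph \<Rightarrow> bool" where
  "connected_graph G \<longleftrightarrow> verts G \<noteq> {} \<and>
     (\<forall>u\<in>verts G. \<forall>v\<in>verts G. (u, v) \<in> (adjacency G)\<^sup>*)"

definition bipartite_graph :: "('v, 'e) multigraph \<Rightarrow> bool" where
  "bipartite_graph G \<longleftrightarrow> (\<exists>A B. A \<union> B = verts G \<and> A \<inter> B = {} \<and>
     (\<forall>e\<in>edges G. \<exists>a\<in>A. \<exists>b\<in>B. ends G e = {a, b}))"

definition delete_edge :: "('v, 'e) multigraph \<Rightarrow> 'e \<Rightarrow> ('v, 'e) multigraph" where
  "delete_edge G e = G\<lparr>edges := edges G - {e}\<rparr>"

definition perfect_matching :: "('v, 'e) multigraph \<Rightarrow> 'e set \<Rightarrow> bool" where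
  "perfect_matching G M \<longleftrightarrow> M \<subseteq> edges G \<and> (\<forall>v\<in>verts G. \<exists>!e. e \<in> M \<and> v \<in> ends G e)"

definition matching_covered :: "('v, 'e) multigraph \<Rightarrow> bool" where
  "matching_covered G \<longleftrightarrow> is_graph G \<and> connected_graph G \<and> 4 \<le> card (verts G) \<and>
     (\<forall>e\<in>edges G. \<exists>M. perfect_matching G M \<and> e \<in> M)"

definition minimal_matching_covered :: "('v, 'e) multigraph \<Rightarrow> bool" where
  "minimal_matching_covered G \<longleftrightarrow> matching_covered G \<and>
     (\<forall>e\<in>edges G. \<not> matching_covered (delete_edge G e))"

definition minimal_bipartite_matching_covered :: "('v, 'e) multigraph \<Rightarrow> bool" where
  "minimal_bipartite_matching_covered G \<longleftrightarrow> bipartite_graph G \<and> minimal_matching_covered G"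

definition degree_two_verts :: "('v, 'e) multigraph \<Rightarrow> 'v set" where
  "degree_two_verts G = {v \<in> verts G. degree G v = 2}"

definition two_vertex_extremal :: "('v, 'e) multigraph \<Rightarrow> bool" where
  "two_vertex_extremal G \<longleftrightarrow> minimal_bipartite_matching_covered G \<and>
     real (card (degree_two_verts G)) = 2 * (real (card (edges G)) - real (card (verts G)) + 2)"

definition two_vertex_n_extremal :: "('v, 'e) multigraph \<Rightarrow> bool" where
  "two_vertex_n_extremal G \<longleftrightarrow> minimal_bipartite_matching_covered G \<and>
     real (card (degree_two_verts G)) = real (card (verts G)) / 2 + 2"

definition edge_extremal :: "('v, 'e) multigraph \<Rightarrow> bool" where
  "edge_extremal G \<longleftrightarrow> minimal_bipartite_matching_covered G \<and>
     real (card (edges G)) = (3 * real (card (verts G)) - 6) / 2"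

(* The edge es ! i joins vs ! i to its cyclic successor. Two parallel edges form a cycle
   of length 2. *)
definition is_cycle :: "('v, 'e) multigraph \<Rightarrow> 'v list \<Rightarrow> 'e list \<Rightarrow> bool" where
  "is_cycle G vs es \<longleftrightarrow> 2 \<le> length vs \<and> length es = length vs \<and>
     distinct vs \<and> distinct es \<and> set vs \<subseteq> verts G \<and> set es \<subseteq> edges G \<and>
     (\<forall>i<length vs. ends G (es ! i) = {vs ! i, vs ! (Suc i mod length vs)})"

definition is_tree :: "('v, 'e) multigraph \<Rightarrow> bool" where
  "is_tree T \<longleftrightarrow> is_graph T \<and> connected_graph T \<and> (\<nexists>vs es. is_cycle T vs es)"

definition leaves :: "('v, 'e) multigraph \<Rightarrow> 'v set" where
  "leaves T = {v \<in> verts T. degree T v = 1}"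

definition halin_tree :: "('v, 'e) multigraph \<Rightarrow> bool" where
  "halin_tree T \<longleftrightarrow> is_tree T \<and> 2 \<le> card (verts T) \<and> (\<forall>v\<in>verts T. degree T v \<noteq> 2)"

definition cubic_halin_tree :: "('v, 'e) multigraph \<Rightarrow> bool" where
  "cubic_halin_tree T \<longleftrightarrow> halin_tree T \<and> (\<forall>v\<in>verts T - leaves T. degree T v = 3)"

definition is_star :: "('v, 'e) multigraph \<Rightarrow> bool" where
  "is_star T \<longleftrightarrow> (\<exists>c L. finite L \<and> 2 \<le> card L \<and> c \<notin> L \<and> verts T = insert c L \<and>
     bij_betw (ends T) (edges T) ((\<lambda>l. {c, l}) ` L))"

definition graph_isomorphism ::
  "('v, 'e) multigraph \<Rightarrow> ('w, 'f) multigraph \<Rightarrow> ('v \<Rightarrow> 'w) \<Rightarrow> ('e \<Rightarrow> 'f) \<Rightarrow> bool" where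
  "graph_isomorphism G H \<phi> \<psi> \<longleftrightarrow>
     bij_betw \<phi> (verts G) (verts H) \<and> bij_betw \<psi> (edges G) (edges H) \<and>
     (\<forall>e\<in>edges G. ends H (\<psi> e) = \<phi> ` ends G e)"

(* T' is the disjoint copy of T, and \<mu> l is the new edge added at the leaf l. *)
definition isomorphic_leaf_matching ::
  "('v, 'e) multigraph \<Rightarrow> ('v, 'e) multigraph \<Rightarrow> bool" where
  "isomorphic_leaf_matching T G \<longleftrightarrow> is_tree T \<and> 2 \<le> card (verts T) \<and>
     (\<exists>T' \<phi> \<psi> \<mu>. graph_isomorphism T T' \<phi> \<psi> \<and>
        verts T \<inter> verts T' = {} \<and> edges T \<inter> edges T' = {} \<and>
        inj_on \<mu> (leaves T) \<and> \<mu> ` leaves T \<inter> (edges T \<union> edges T') = {} \<and>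
        verts G = verts T \<union> verts T' \<and>
        edges G = edges T \<union> edges T' \<union> \<mu> ` leaves T \<and>
        (\<forall>e\<in>edges T. ends G e = ends T e) \<and>
        (\<forall>e\<in>edges T'. ends G e = ends T' e) \<and>
        (\<forall>l\<in>leaves T. ends G (\<mu> l) = {l, \<phi> l}))"

end

theory Submission imports Defs begin

text \<open>A matching \<open>N\<close> of \<open>T\<close> that covers all non-leaves, its copy, and the new edges at the leaves missed
  by \<open>N\<close> form a perfect matching of \<open>G\<close>. Greedy matchings from a root show that \<open>N\<close> may be required
  to contain a given edge, or to miss a given leaf, so every edge of \<open>G\<close> is covered.
  For minimality, each edge is forced by some other edge: a tree edge and its copy form a 2-cut
  with even sides, hence lie in the same perfect matchings; and the two edges at a leaf, which has
  degree two, exclude each other. The extremality claims follow from \<open>m - n + 2\<close> being the number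
  of leaves of \<open>T\<close>.\<close>

section \<open>Trees\<close>

lemma adjacency_sym: "(u, v) \<in> adjacency G \<Longrightarrow> (v, u) \<in> adjacency G"
  by (auto simp: adjacency_def insert_commute)

lemma adjacency_rtrancl_sym: "(u, v) \<in> (adjacency G)\<^sup>* \<Longrightarrow> (v, u) \<in> (adjacency G)\<^sup>*"
  by (metis adjacency_sym symI symD sym_rtrancl)

lemma adjacency_in_verts:
  assumes "is_graph G" "(u, v) \<in> adjacency G"
  shows "u \<in> verts G" "v \<in> verts G"
  using assms by (auto simp: adjacency_def is_graph_def)

lemma delete_edge_simps [simp]:
  "verts (delete_edge G e) = verts G"
  "edges (delete_edge G e) = edges G - {e}"
  "ends (delete_edge G e) = ends G"
  by (simp_all add: delete_edge_def)

text \<open>If a shortest walk visited a vertex twice, cutting out the part between the two visits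
  would leave a shorter walk with the same ends.\<close>

lemma shortest_walk_inj:
  assumes "(u, v) \<in> R\<^sup>*"
  obtains f n where "f 0 = u" "f n = v" "\<forall>i<n. (f i, f (Suc i)) \<in> R" "inj_on f {..n}"
proof -
  define n where "n = (LEAST n. (u, v) \<in> R ^^ n)"
  have n: "(u, v) \<in> R ^^ n"
    unfolding n_def using assms by (metis LeastI rtrancl_imp_relpow)
  then obtain f where f: "f 0 = u" "f n = v" "\<forall>i<n. (f i, f (Suc i)) \<in> R"
    by (auto simp: relpow_fun_conv)
  have seg: "(f i, f j) \<in> R ^^ (j - i)" if "i \<le> j" "j \<le> n" for i j
    using that f(3) by (auto simp: relpow_fun_conv intro!: exI[of _ "\<lambda>k. f (i + k)"])
  have False if "i < j" "j \<le> n" "f i = f j" for i j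
  proof -
    have "(u, f i) \<in> R ^^ i" "(f i, v) \<in> R ^^ (n - j)"
      using seg[of 0 i] seg[of j n] that f by auto
    then have "(u, v) \<in> R ^^ (i + (n - j))"
      by (auto simp: relpow_add)
    then have "n \<le> i + (n - j)"
      unfolding n_def by (rule Least_le)
    then show False using that by linarith
  qed
  then have "inj_on f {..n}"
    by (intro inj_onI) (metis atMost_iff nat_neq_iff)
  with f show ?thesis by (rule that)
qed

text \<open>A walk from \<open>u\<close> to \<open>v\<close> avoiding \<open>e\<close> can be taken
  to be a path, and closing that path with \<open>e\<close> gives a cycle. If the path is a single
  edge, it is parallel to \<open>e\<close>, and the cycle has length two.\<close>

lemma tree_edge_is_bridge:
  assumes T: "is_tree T" and e: "e \<in> edges T" "ends T e = {u, v}"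
  shows "(u, v) \<notin> (adjacency (delete_edge T e))\<^sup>*"
proof
  let ?R = "adjacency (delete_edge T e)"
  assume "(u, v) \<in> ?R\<^sup>*"
  then obtain f n where f: "f 0 = u" "f n = v" "\<forall>i<n. (f i, f (Suc i)) \<in> ?R" "inj_on f {..n}"
    by (rule shortest_walk_inj)
  have gr: "is_graph T" using T by (simp add: is_tree_def)
  then have uv: "u \<noteq> v" "u \<in> verts T" "v \<in> verts T"
    using e by (auto simp: is_graph_def)
  then have n: "0 < n" using f by (cases n) auto
  have "\<exists>g. \<forall>i<n. g i \<in> edges T - {e} \<and> ends T (g i) = {f i, f (Suc i)}"
    using f(3) by (intro choice) (auto simp: adjacency_def)
  then obtain g where g: "\<And>i. i < n \<Longrightarrow> g i \<in> edges T - {e}"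
      "\<And>i. i < n \<Longrightarrow> ends T (g i) = {f i, f (Suc i)}" by blast
  \<comment> \<open>The path has \<open>n + 1\<close> vertices and \<open>n\<close> edges. Appending
    \<open>e\<close> at index \<open>n\<close> makes it the closing edge from \<open>f n = v\<close>
    back to \<open>f 0 = u\<close>, where the successor index wraps around to 0.\<close>
  define vs where "vs = map f [0..<Suc n]"
  define es where "es = map g [0..<n] @ [e]"
  have f_eq: "f i = f j \<longleftrightarrow> i = j" if "i \<le> n" "j \<le> n" for i j
    using f(4) that by (auto simp: inj_on_def)
  have "inj_on g {..<n}"
  proof (rule inj_onI)
    fix i j assume ij: "i \<in> {..<n}" "j \<in> {..<n}" "g i = g j"
    then have "{f i, f (Suc i)} = {f j, f (Suc j)}" using g(2) by (metis lessThan_iff)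
    then show "i = j" using ij by (auto simp: doubleton_eq_iff f_eq)
  qed
  then have d_es: "distinct es"
    using g(1) by (auto simp: es_def distinct_map atLeast0LessThan)
  have d_vs: "distinct vs"
    using f(4) by (simp add: vs_def distinct_map atLeast0LessThan lessThan_Suc_atMost del: upt_Suc)
  have f_verts: "f i \<in> verts T" if "i \<le> n" for i
  proof (cases "i = n")
    case True
    then show ?thesis using f(2) uv by simp
  next
    case False
    then have "i < n" using that by simp
    from g[OF this] gr show ?thesis by (force simp: is_graph_def)
  qed
  have "ends T (es ! i) = {vs ! i, vs ! (Suc i mod length vs)}" if "i < length vs" for i
  proof (cases "i = n")
    case True
    then show ?thesis using e(2) f
      by (simp add: es_def vs_def nth_append insert_commute del: upt_Suc)
  next
    case False
    then have "i < n" using that by (simp add: vs_def)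
    then show ?thesis using g(2)[of i] by (simp add: es_def vs_def nth_append del: upt_Suc)
  qed
  then have "is_cycle T vs es"
    using n d_es d_vs g(1) e(1) f_verts
    by (auto simp: is_cycle_def vs_def es_def simp del: upt_Suc)
  then show False using T by (auto simp: is_tree_def)
qed

text \<open>The parent edges of a breadth-first tree reach every edge of a tree, since any other edge
  could be deleted without disconnecting its ends.\<close>

lemma tree_rooted:
  assumes T: "is_tree T" and r: "r \<in> verts T"
  obtains d :: "'v \<Rightarrow> nat" and par :: "'v \<Rightarrow> 'v" and pe :: "'v \<Rightarrow> 'e"
  where "d r = 0" "bij_betw pe (verts T - {r}) (edges (T :: ('v, 'e) multigraph))"
    "\<And>v. v \<in> verts T - {r} \<Longrightarrow> par v \<in> verts T"
    "\<And>v. v \<in> verts T - {r} \<Longrightarrow> ends T (pe v) = {v, par v}"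
    "\<And>v. v \<in> verts T - {r} \<Longrightarrow> d v = Suc (d (par v))"
proof -
  let ?R = "adjacency T"
  \<comment> \<open>The breadth-first depth. The parent of \<open>v\<close> is the last vertex
    before \<open>v\<close> on a shortest walk from \<open>r\<close>.\<close>
  define d where "d v = (LEAST n. (r, v) \<in> ?R ^^ n)" for v
  have gr: "is_graph T" and conn: "connected_graph T"
    using T by (auto simp: is_tree_def)
  have d_path: "(r, v) \<in> ?R ^^ d v" if "v \<in> verts T" for v
  proof -
    have "(r, v) \<in> ?R\<^sup>*" using conn r that by (auto simp: connected_graph_def)
    then show ?thesis unfolding d_def by (metis LeastI rtrancl_imp_relpow)
  qed
  have d_le: "d v \<le> n" if "(r, v) \<in> ?R ^^ n" for v n
    unfolding d_def using that by (rule Least_le)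
  have "\<exists>w e. w \<in> verts T \<and> e \<in> edges T \<and> ends T e = {v, w} \<and> d v = Suc (d w)"
    if v: "v \<in> verts T - {r}" for v
  proof -
    have path: "(r, v) \<in> ?R ^^ d v" using d_path v by blast
    then have "d v \<noteq> 0" using v by (metis DiffE relpow_0_E singletonI)
    then obtain k where k: "d v = Suc k" by (cases "d v") auto
    then obtain w where w: "(r, w) \<in> ?R ^^ k" "(w, v) \<in> ?R"
      using path by (metis relpow_Suc_E)
    have wV: "w \<in> verts T" using adjacency_in_verts[OF gr w(2)] by blast
    have "(r, v) \<in> ?R ^^ Suc (d w)" using d_path[OF wV] w(2) by (rule relpow_Suc_I)
    then have "d v = Suc (d w)" using d_le[of v "Suc (d w)"] d_le[OF w(1)] k by simp
    with w(2) wV show ?thesis by (auto simp: adjacency_def insert_commute)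
  qed
  then obtain par pe where p: "\<And>v. v \<in> verts T - {r} \<Longrightarrow> par v \<in> verts T"
      "\<And>v. v \<in> verts T - {r} \<Longrightarrow> pe v \<in> edges T"
      "\<And>v. v \<in> verts T - {r} \<Longrightarrow> ends T (pe v) = {v, par v}"
      "\<And>v. v \<in> verts T - {r} \<Longrightarrow> d v = Suc (d (par v))"
    by metis
  have d0: "d r = 0" using d_le[of r 0] by simp
  have "inj_on pe (verts T - {r})"
  proof (rule inj_onI)
    fix v w assume vw: "v \<in> verts T - {r}" "w \<in> verts T - {r}" "pe v = pe w"
    then have "{v, par v} = {w, par w}" using p(3) by metis
    \<comment> \<open>Two distinct vertices with the same parent edge would be parents of each
      other, so each would lie one level below the other.\<close>
    then consider "v = w" | "par v = w" "par w = v" by (auto simp: doubleton_eq_iff)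
    then show "v = w" using p(4)[OF vw(1)] p(4)[OF vw(2)] by cases auto
  qed
  moreover have "e \<in> pe ` (verts T - {r})" if e: "e \<in> edges T" for e
  proof (rule ccontr)
    assume ne: "e \<notin> pe ` (verts T - {r})"
    let ?S = "adjacency (delete_edge T e)"
    \<comment> \<open>All parent edges survive the deletion of \<open>e\<close>, so induction on the
      depth still reaches every vertex from \<open>r\<close>. In particular the ends of
      \<open>e\<close> stay connected, against \<open>e\<close> being a bridge.\<close>
    have reach: "(r, v) \<in> ?S\<^sup>*" if "v \<in> verts T" for v
      using that
    proof (induction "d v" arbitrary: v rule: less_induct)
      case less
      show ?case
      proof (cases "v = r")
        case False
        then have v: "v \<in> verts T - {r}" using less.prems by simp
        have "(r, par v) \<in> ?S\<^sup>*" using less.hyps p(1,4)[OF v] by simp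
        moreover have "pe v \<noteq> e" using ne v by blast
        then have "(par v, v) \<in> ?S"
          using p(2,3)[OF v] by (auto simp: adjacency_def insert_commute)
        ultimately show ?thesis by simp
      qed simp
    qed
    obtain u v where uv: "ends T e = {u, v}"
      using gr e by (auto simp: is_graph_def card_2_iff)
    then have "u \<in> verts T" "v \<in> verts T" using gr e by (auto simp: is_graph_def)
    then have "(u, v) \<in> ?S\<^sup>*" using reach adjacency_rtrancl_sym by (metis rtrancl_trans)
    then show False using tree_edge_is_bridge[OF T e uv] by blast
  qed
  ultimately have "bij_betw pe (verts T - {r}) (edges T)"
    using p(2) by (auto simp: bij_betw_def)
  with d0 show ?thesis using p(1,3,4) by (rule that)
qed

text \<open>Parent edges put the vertices other than a root in bijection with the edges.\<close>

lemma tree_card_edges: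
  assumes T: "is_tree T"
  shows "card (verts T) = Suc (card (edges T))"
proof -
  obtain r where r: "r \<in> verts T" using T by (auto simp: is_tree_def connected_graph_def)
  obtain d :: "'a \<Rightarrow> nat" and par pe where "bij_betw pe (verts T - {r}) (edges T)"
    using tree_rooted[OF T r] by metis
  then have "card (verts T - {r}) = card (edges T)" by (rule bij_betw_same_card)
  moreover have "finite (verts T)" using T by (auto simp: is_tree_def is_graph_def)
  ultimately show ?thesis using r by (metis card_Suc_Diff1)
qed

text \<open>Colour by the parity of the depth: every edge is a parent edge and so joins consecutive
  levels.\<close>

lemma tree_two_colouring:
  fixes T :: "('v, 'e) multigraph"
  assumes T: "is_tree T"
  obtains c :: "'v \<Rightarrow> bool" where "\<And>e u v. e \<in> edges T \<Longrightarrow> ends T e = {u, v} \<Longrightarrow> c u \<noteq> c v"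
proof -
  obtain r where r: "r \<in> verts T" using T by (auto simp: is_tree_def connected_graph_def)
  obtain d :: "'v \<Rightarrow> nat" and par pe where d: "bij_betw pe (verts T - {r}) (edges T)"
    "\<And>v. v \<in> verts T - {r} \<Longrightarrow> ends T (pe v) = {v, par v}"
    "\<And>v. v \<in> verts T - {r} \<Longrightarrow> d v = Suc (d (par v))"
    using tree_rooted[OF T r] by metis
  have "even (d u) \<noteq> even (d v)" if e: "e \<in> edges T" "ends T e = {u, v}" for e u v
  proof -
    obtain w where w: "w \<in> verts T - {r}" "e = pe w"
      using d(1) e(1) by (auto simp: bij_betw_def)
    then have "{u, v} = {w, par w}" using d(2) e(2) by metis
    then show ?thesis using d(3)[OF w(1)] by (auto simp: doubleton_eq_iff)
  qed
  then show ?thesis by (rule that)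
qed

section \<open>Degrees, double counting and the existence of a leaf\<close>

lemma degree_pos:
  assumes "is_graph G" "connected_graph G" "2 \<le> card (verts G)" "v \<in> verts G"
  shows "0 < degree G v"
proof -
  have "\<not> verts G \<subseteq> {v}"
  proof
    assume "verts G \<subseteq> {v}"
    then have "card (verts G) \<le> card {v}" by (intro card_mono) auto
    with assms(3) show False by simp
  qed
  then obtain w where w: "w \<in> verts G" "w \<noteq> v" by blast
  then have "(v, w) \<in> (adjacency G)\<^sup>*" using assms by (auto simp: connected_graph_def)
  then obtain x where "(v, x) \<in> adjacency G" using w(2) by (metis converse_rtranclE)
  then have "{e \<in> edges G. v \<in> ends G e} \<noteq> {}" by (auto simp: adjacency_def)
  moreover have "finite (edges G)" using assms(1) by (simp add: is_graph_def)
  ultimately show ?thesis by (simp add: degree_def card_gt_0_iff)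
qed

text \<open>Double counting of incidences between \<open>X\<close> and \<open>F\<close>. Taking all
  edges for \<open>F\<close> gives the handshake identity; taking a perfect matching gives the
  parity of its intersection with a cut.\<close>

lemma sum_incidences:
  assumes "finite X" "finite F"
  shows "(\<Sum>v\<in>X. card {e \<in> F. v \<in> ends G e}) = (\<Sum>e\<in>F. card (ends G e \<inter> X))"
proof -
  have "(\<Sum>v\<in>X. card {e \<in> F. v \<in> ends G e}) = (\<Sum>v\<in>X. \<Sum>e\<in>F. if v \<in> ends G e then 1 else 0)"
    using assms by (simp add: sum.If_cases Int_def)
  also have "\<dots> = (\<Sum>e\<in>F. \<Sum>v\<in>X. if v \<in> ends G e then 1 else 0)" by (rule sum.swap)
  also have "\<dots> = (\<Sum>e\<in>F. card (ends G e \<inter> X))"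
    using assms by (simp add: sum.If_cases Int_def conj_commute)
  finally show ?thesis .
qed

lemma handshake:
  assumes "is_graph G"
  shows "(\<Sum>v\<in>verts G. degree G v) = 2 * card (edges G)"
proof -
  have "(\<Sum>v\<in>verts G. degree G v) = (\<Sum>e\<in>edges G. card (ends G e \<inter> verts G))"
    unfolding degree_def using assms by (intro sum_incidences) (auto simp: is_graph_def)
  also have "\<dots> = (\<Sum>e\<in>edges G. 2)"
    using assms by (intro sum.cong) (auto simp: is_graph_def Int_absorb2)
  finally show ?thesis by simp
qed

text \<open>Without leaves all degrees would be at least two, so the degree sum would be at least
  \<open>2 * card (verts T)\<close>; but it is twice the number of edges, which is one less than the
  number of vertices.\<close>

lemma tree_has_leaf:
  assumes T: "is_tree T" "2 \<le> card (verts T)"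
  shows "leaves T \<noteq> {}"
proof
  assume no: "leaves T = {}"
  have gr: "is_graph T" "connected_graph T" using T by (auto simp: is_tree_def)
  have "2 \<le> degree T v" if "v \<in> verts T" for v
    using degree_pos[OF gr T(2) that] no that by (force simp: leaves_def)
  then have "(\<Sum>v\<in>verts T. 2) \<le> (\<Sum>v\<in>verts T. degree T v)" by (rule sum_mono)
  then show False using handshake[OF gr(1)] tree_card_edges[OF T(1)] by simp
qed

section \<open>Matchings\<close>

text \<open>Leaves may stay exposed, because in \<open>G\<close> an exposed leaf \<open>l\<close>
  and its copy can be covered together by the edge \<open>\<mu> l\<close>.\<close>

definition nonleaf_matching :: "('v, 'e) multigraph \<Rightarrow> 'e set \<Rightarrow> bool" where
  "nonleaf_matching T N \<longleftrightarrow> N \<subseteq> edges T \<and>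
     (\<forall>v\<in>verts T. \<forall>e\<in>N. \<forall>f\<in>N. v \<in> ends T e \<longrightarrow> v \<in> ends T f \<longrightarrow> e = f) \<and>
     (\<forall>v\<in>verts T - leaves T. \<exists>e\<in>N. v \<in> ends T e)"

text \<open>Choose a child \<open>ch v\<close> of every vertex having one, and walk down from the root: a vertex not
  matched to its parent is matched to its chosen child. If \<open>b\<close> holds, the root, then a leaf,
  is declared matched already and stays exposed.\<close>

lemma tree_nonleaf_matching:
  fixes T :: "('v, 'e) multigraph"
  assumes T: "is_tree T" "2 \<le> card (verts T)"
    and e0: "e\<^sub>0 \<in> edges T" "r \<in> ends T e\<^sub>0" and b: "b \<Longrightarrow> r \<in> leaves T"
  shows "\<exists>N. nonleaf_matching T N \<and> (if b then \<forall>e\<in>N. r \<notin> ends T e else e\<^sub>0 \<in> N)"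
proof -
  have gr: "is_graph T" "connected_graph T" using T by (auto simp: is_tree_def)
  have r: "r \<in> verts T" using gr e0 by (auto simp: is_graph_def)
  obtain d :: "'v \<Rightarrow> nat" and par pe where d: "d r = 0"
    "bij_betw pe (verts T - {r}) (edges T)"
    "\<And>v. v \<in> verts T - {r} \<Longrightarrow> par v \<in> verts T"
    "\<And>v. v \<in> verts T - {r} \<Longrightarrow> ends T (pe v) = {v, par v}"
    "\<And>v. v \<in> verts T - {r} \<Longrightarrow> d v = Suc (d (par v))"
    using tree_rooted[OF T(1) r] by metis
  have edge: "\<exists>w\<in>verts T - {r}. e = pe w" if "e \<in> edges T" for e
    using d(2) that by (auto simp: bij_betw_def)
  obtain s where s: "s \<in> verts T - {r}" "e\<^sub>0 = pe s" using edge[OF e0(1)] by blast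
  have par_s: "par s = r" using d(4)[OF s(1)] s e0(2) by auto
  \<comment> \<open>The root's chosen child is fixed to be \<open>s\<close>, the lower end of
    \<open>e\<^sub>0\<close>, so that \<open>e\<^sub>0\<close> is selected whenever the root is not
    declared matched. The arbitrary value at a childless vertex has no effect, since
    \<open>ch\<close> is only evaluated at parents and at vertices shown to have a child.\<close>
  define ch where "ch v = (if v = r then s else SOME w. w \<in> verts T - {r} \<and> par w = v)" for v
  \<comment> \<open>\<open>M v\<close> is to mean that \<open>v\<close> is matched to its parent. It
    is a recursion along the depth: \<open>Q n\<close> decides this for vertices at depth
    \<open>n\<close>, and depth 0 carries the declared status \<open>b\<close> of the root.\<close>
  define Q where "Q = rec_nat (\<lambda>_. b) (\<lambda>_ q v. v = ch (par v) \<and> \<not> q (par v))"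
  define M where "M v = Q (d v) v" for v
  have M_r: "M r = b" by (simp add: M_def Q_def d(1))
  have M_iff: "M v \<longleftrightarrow> v = ch (par v) \<and> \<not> M (par v)" if "v \<in> verts T - {r}" for v
    using d(5)[OF that] by (simp add: M_def Q_def)
  define N where "N = pe ` {v \<in> verts T - {r}. M v}"
  have N_sub: "N \<subseteq> edges T" using d(2) by (auto simp: N_def bij_betw_def)
  \<comment> \<open>If \<open>v\<close> is the upper end of both edges, both lower ends equal
    \<open>ch v\<close>. If \<open>v\<close> is the upper end of one and the lower end of the other,
    then \<open>M v\<close> holds, and this forbids selecting a child of \<open>v\<close>.\<close>
  have uniq: "w = w'"
    if "w \<in> verts T - {r}" "M w" "w' \<in> verts T - {r}" "M w'"
      and "v \<in> {w, par w}" "v \<in> {w', par w'}" for v w w'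
    using that M_iff[of w] M_iff[of w'] by auto
  have "e = f" if "e \<in> N" "f \<in> N" "v \<in> ends T e" "v \<in> ends T f" for v e f
  proof -
    obtain w w' where w: "w \<in> verts T - {r}" "M w" "e = pe w" "w' \<in> verts T - {r}" "M w'" "f = pe w'"
      using \<open>e \<in> N\<close> \<open>f \<in> N\<close> unfolding N_def by blast
    then have "w = w'" using that d(4) uniq[of w w' v] by auto
    then show ?thesis using w by simp
  qed
  moreover have "\<exists>e\<in>N. v \<in> ends T e" if v: "v \<in> verts T - leaves T" for v
  proof (cases "M v")
    case True
    then have "v \<noteq> r" using M_r b v by auto
    then show ?thesis using True v d(4)[of v] by (auto simp: N_def)
  next
    case False
    have "ch v \<in> verts T - {r} \<and> par (ch v) = v"
    proof (cases "v = r")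
      case True
      then show ?thesis using s par_s by (simp add: ch_def)
    next
      case False
      let ?I = "{e \<in> edges T. v \<in> ends T e}"
      have "0 < degree T v" "degree T v \<noteq> 1"
        using degree_pos[OF gr T(2)] v by (auto simp: leaves_def)
      \<comment> \<open>A non-leaf other than the root has degree at least two, so some edge at it
        is not its parent edge; that edge is the parent edge of a child.\<close>
      then have "\<not> ?I \<subseteq> {pe v}"
        using card_mono[of "{pe v}" ?I] by (force simp: degree_def)
      then obtain e where e: "e \<in> edges T" "v \<in> ends T e" "e \<noteq> pe v" by blast
      then obtain w where "w \<in> verts T - {r}" "e = pe w" using edge by blast
      then have "w \<in> verts T - {r} \<and> par w = v" using e d(4)[of w] by auto
      then show ?thesis using False by (simp add: ch_def) (rule someI)
    qed
    then have "M (ch v)" "ch v \<in> verts T - {r}" "v \<in> ends T (pe (ch v))"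
      using M_iff[of "ch v"] False d(4)[of "ch v"] by auto
    then show ?thesis by (auto simp: N_def)
  qed
  ultimately have "nonleaf_matching T N" using N_sub by (auto simp: nonleaf_matching_def)
  \<comment> \<open>An edge of \<open>N\<close> at the root would come from a child of the root, and
    \<open>M r\<close>, which equals \<open>b\<close>, blocks all of these.\<close>
  moreover have "r \<notin> ends T e" if "b" "e \<in> N" for e
  proof
    assume "r \<in> ends T e"
    moreover obtain w where w: "w \<in> verts T - {r}" "M w" "e = pe w"
      using \<open>e \<in> N\<close> unfolding N_def by blast
    ultimately have "par w = r" using d(4)[of w] by auto
    then show False using M_iff[OF w(1)] w(2) M_r that by simp
  qed
  moreover have "e\<^sub>0 \<in> N" if "\<not> b"
    using that s par_s M_iff[OF s(1)] M_r by (auto simp: N_def ch_def)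
  ultimately show ?thesis by auto
qed

text \<open>Each vertex of \<open>X\<close> is met by exactly one edge of \<open>M\<close>, so
  \<open>card X\<close> is the sum of \<open>card (ends G e \<inter> X)\<close> over
  \<open>M\<close>. Modulo two only the odd terms remain, and these belong to the edges of
  \<open>M\<close> with exactly one end in \<open>X\<close>.\<close>

lemma perfect_matching_parity:
  assumes G: "is_graph G" and M: "perfect_matching G M" and X: "X \<subseteq> verts G"
  shows "even (card X) \<longleftrightarrow> even (card {e \<in> M. odd (card (ends G e \<inter> X))})"
proof -
  have fin: "finite X" "finite M"
    using G M X by (auto simp: is_graph_def perfect_matching_def intro: finite_subset)
  have "card {e \<in> M. v \<in> ends G e} = 1" if "v \<in> X" for v
  proof -
    have "\<exists>!e. e \<in> M \<and> v \<in> ends G e" using M X that unfolding perfect_matching_def by blast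
    then obtain e where "{e \<in> M. v \<in> ends G e} = {e}" by blast
    then show ?thesis by simp
  qed
  then have "card X = (\<Sum>v\<in>X. card {e \<in> M. v \<in> ends G e})" by simp
  also have "\<dots> = (\<Sum>e\<in>M. card (ends G e \<inter> X))" using fin by (rule sum_incidences)
  finally show ?thesis using fin by (simp add: even_sum_iff)
qed

text \<open>If \<open>f\<close> forces \<open>e\<close>, then no perfect matching through
  \<open>f\<close> survives the deletion of \<open>e\<close>, so \<open>f\<close> is no longer
  covered.\<close>

lemma not_matching_covered_deleteI:
  assumes "f \<in> edges G" "f \<noteq> e" and "\<And>M. perfect_matching G M \<Longrightarrow> f \<in> M \<Longrightarrow> e \<in> M"
  shows "\<not> matching_covered (delete_edge G e)"
proof
  assume "matching_covered (delete_edge G e)"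
  then obtain M where "perfect_matching (delete_edge G e) M" "f \<in> M"
    using assms(1,2) by (auto simp: matching_covered_def)
  moreover from this have "perfect_matching G M" "e \<notin> M"
    by (auto simp: perfect_matching_def)
  ultimately show False using assms(3) by blast
qed

section \<open>Isomorphic leaf matchings\<close>

text \<open>The witnesses of \<open>isomorphic_leaf_matching\<close> are fixed once, so that all
  facts about \<open>G\<close> can refer to the same copy, isomorphism and new edges.\<close>

locale leaf_matching =
  fixes T T' G :: "('v, 'e) multigraph" and \<phi> :: "'v \<Rightarrow> 'v" and \<psi> \<mu>
  assumes tree: "is_tree T" and card_T: "2 \<le> card (verts T)"
    and iso: "graph_isomorphism T T' \<phi> \<psi>"
    and verts_disjoint: "verts T \<inter> verts T' = {}"
    and edges_disjoint: "edges T \<inter> edges T' = {}"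
    and inj_mu: "inj_on \<mu> (leaves T)"
    and mu_disjoint: "\<mu> ` leaves T \<inter> (edges T \<union> edges T') = {}"
    and verts_union: "verts G = verts T \<union> verts T'"
    and edges_union: "edges G = edges T \<union> edges T' \<union> \<mu> ` leaves T"
    and ends_T: "\<And>e. e \<in> edges T \<Longrightarrow> ends G e = ends T e"
    and ends_T': "\<And>e. e \<in> edges T' \<Longrightarrow> ends G e = ends T' e"
    and ends_mu: "\<And>l. l \<in> leaves T \<Longrightarrow> ends G (\<mu> l) = {l, \<phi> l}"
begin

lemma graph_T: "is_graph T" and connected_T: "connected_graph T"
  using tree by (auto simp: is_tree_def)

lemma finite_T: "finite (verts T)" "finite (edges T)" "finite (leaves T)"
  using graph_T by (auto simp: is_graph_def leaves_def)

lemma leaves_subset: "leaves T \<subseteq> verts T"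
  by (auto simp: leaves_def)

lemma ends_subset: "e \<in> edges T \<Longrightarrow> ends T e \<subseteq> verts T"
  and card_ends: "e \<in> edges T \<Longrightarrow> card (ends T e) = 2"
  using graph_T by (auto simp: is_graph_def)

lemma inj_phi: "inj_on \<phi> (verts T)" and inj_psi: "inj_on \<psi> (edges T)"
  using iso by (auto simp: graph_isomorphism_def bij_betw_def)

lemma verts_T': "verts T' = \<phi> ` verts T" and edges_T': "edges T' = \<psi> ` edges T"
  using iso by (auto simp: graph_isomorphism_def bij_betw_def)

lemma verts_G: "verts G = verts T \<union> \<phi> ` verts T"
  using verts_union verts_T' by simp

lemma edges_G: "edges G = edges T \<union> \<psi> ` edges T \<union> \<mu> ` leaves T"
  using edges_union edges_T' by simp

lemma ends_psi: "e \<in> edges T \<Longrightarrow> ends G (\<psi> e) = \<phi> ` ends T e"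
  using ends_T' edges_T' iso by (auto simp: graph_isomorphism_def)

lemma phi_notin: "v \<in> verts T \<Longrightarrow> \<phi> v \<notin> verts T"
  using verts_disjoint verts_T' by blast

lemma psi_notin: "e \<in> edges T \<Longrightarrow> \<psi> e \<notin> edges T"
  using edges_disjoint edges_T' by blast

lemma phi_eq: "u \<in> verts T \<Longrightarrow> v \<in> verts T \<Longrightarrow> \<phi> u = \<phi> v \<longleftrightarrow> u = v"
  using inj_phi by (auto simp: inj_on_def)

lemma mu_notin: "l \<in> leaves T \<Longrightarrow> \<mu> l \<notin> edges T \<and> \<mu> l \<notin> \<psi> ` edges T"
  using mu_disjoint edges_T' by blast

text \<open>Together with \<open>incident_copy\<close> this lists the edges of \<open>G\<close> at
  each vertex by kind; the degree counts and the verification of perfect matchings reduce to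
  it.\<close>

lemma incident_vert:
  assumes "v \<in> verts T"
  shows "e \<in> edges T \<Longrightarrow> v \<in> ends G e \<longleftrightarrow> v \<in> ends T e"
    and "e \<in> edges T \<Longrightarrow> v \<notin> ends G (\<psi> e)"
    and "l \<in> leaves T \<Longrightarrow> v \<in> ends G (\<mu> l) \<longleftrightarrow> v = l"
  using assms ends_subset[of e] phi_notin leaves_subset by (auto simp: ends_T ends_psi ends_mu)

lemma incident_copy:
  assumes "v \<in> verts T"
  shows "e \<in> edges T \<Longrightarrow> \<phi> v \<notin> ends G e"
    and "e \<in> edges T \<Longrightarrow> \<phi> v \<in> ends G (\<psi> e) \<longleftrightarrow> v \<in> ends T e"
    and "l \<in> leaves T \<Longrightarrow> \<phi> v \<in> ends G (\<mu> l) \<longleftrightarrow> v = l"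
proof -
  show "\<phi> v \<notin> ends G e" if "e \<in> edges T"
    using ends_subset[OF that] phi_notin[OF assms] ends_T[OF that] by auto
  show "\<phi> v \<in> ends G (\<psi> e) \<longleftrightarrow> v \<in> ends T e" if "e \<in> edges T"
    using ends_psi[OF that] inj_on_image_mem_iff[OF inj_phi assms ends_subset[OF that]] by simp
  show "\<phi> v \<in> ends G (\<mu> l) \<longleftrightarrow> v = l" if "l \<in> leaves T"
    using that leaves_subset phi_notin[OF assms] phi_eq[OF assms, of l] by (auto simp: ends_mu)
qed

lemma is_graph_G: "is_graph G"
proof -
  have "ends G e \<subseteq> verts G \<and> card (ends G e) = 2" if e: "e \<in> edges G" for e
  proof -
    consider "e \<in> edges T" | f where "f \<in> edges T" "e = \<psi> f" | l where "l \<in> leaves T" "e = \<mu> l"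
      using e edges_G by blast
    then show ?thesis
    proof cases
      case 1
      then show ?thesis using ends_subset card_ends by (auto simp: ends_T verts_G)
    next
      case (2 f)
      then show ?thesis
        using ends_subset[of f] card_ends[of f] card_image[OF inj_on_subset[OF inj_phi]]
        by (auto simp: ends_psi verts_G)
    next
      case (3 l)
      then have "l \<in> verts T" using leaves_subset by blast
      moreover from this have "l \<noteq> \<phi> l" using phi_notin by metis
      ultimately show ?thesis using 3 by (simp add: ends_mu verts_G)
    qed
  qed
  then show ?thesis using finite_T by (auto simp: is_graph_def verts_G edges_G)
qed

section \<open>Numbers of vertices and edges of \<open>G\<close>, and its degrees\<close>

lemma card_verts_G: "card (verts G) = 2 * card (verts T)"
proof -
  have "card (verts G) = card (verts T) + card (\<phi> ` verts T)"
    unfolding verts_G using finite_T phi_notin by (intro card_Un_disjoint) auto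
  then show ?thesis by (simp add: card_image[OF inj_phi])
qed

lemma card_edges_G: "card (edges G) = 2 * card (edges T) + card (leaves T)"
proof -
  have "card (edges G) = card (edges T \<union> \<psi> ` edges T) + card (\<mu> ` leaves T)"
    unfolding edges_G using finite_T mu_notin by (intro card_Un_disjoint) auto
  also have "card (edges T \<union> \<psi> ` edges T) = card (edges T) + card (\<psi> ` edges T)"
    using finite_T psi_notin by (intro card_Un_disjoint) auto
  finally show ?thesis by (simp add: card_image[OF inj_psi] card_image[OF inj_mu])
qed

lemma degree_vert:
  assumes v: "v \<in> verts T"
  shows "degree G v = degree T v + (if v \<in> leaves T then 1 else 0)"
proof -
  have "{e \<in> edges G. v \<in> ends G e} =
      {e \<in> edges T. v \<in> ends T e} \<union> (if v \<in> leaves T then {\<mu> v} else {})"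
    using incident_vert[OF v] by (auto simp: edges_G)
  then show ?thesis using finite_T mu_notin[of v] by (auto simp: degree_def)
qed

lemma degree_copy:
  assumes v: "v \<in> verts T"
  shows "degree G (\<phi> v) = degree T v + (if v \<in> leaves T then 1 else 0)"
proof -
  let ?I = "{e \<in> edges T. v \<in> ends T e}"
  have "{e \<in> edges G. \<phi> v \<in> ends G e} = \<psi> ` ?I \<union> (if v \<in> leaves T then {\<mu> v} else {})"
    using incident_copy[OF v] by (auto simp: edges_G)
  moreover have "card (\<psi> ` ?I) = card ?I"
    by (intro card_image inj_on_subset[OF inj_psi]) auto
  moreover have "\<mu> v \<notin> \<psi> ` ?I" if "v \<in> leaves T" using mu_notin[OF that] by blast
  ultimately show ?thesis using finite_T by (simp add: degree_def)
qed

text \<open>Degrees in \<open>T\<close> are positive, and exactly the vertices of degree one gain a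
  new edge.\<close>

lemma degree_G_ge_two:
  assumes v: "v \<in> verts T"
  shows "2 \<le> degree G v"
  using degree_pos[OF graph_T connected_T card_T v] degree_vert[OF v] v
  by (auto simp: leaves_def)

section \<open>Connectedness and bipartiteness of \<open>G\<close>\<close>

lemma connected_G: "connected_graph G"
proof -
  \<comment> \<open>A leaf exists, so there is at least one new edge. It links the walks to
    \<open>l\<close> inside \<open>T\<close> with the walks to \<open>\<phi> l\<close> inside the
    copy.\<close>
  obtain l where l: "l \<in> leaves T" using tree_has_leaf[OF tree card_T] by blast
  have "(u, l) \<in> (adjacency G)\<^sup>*" if "u \<in> verts G" for u
  proof -
    have conn: "(w, l) \<in> (adjacency T)\<^sup>*" if "w \<in> verts T" for w
      using connected_T l leaves_subset that by (auto simp: connected_graph_def)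
    have adj: "(x, y) \<in> adjacency G" "(\<phi> x, \<phi> y) \<in> adjacency G" if "(x, y) \<in> adjacency T" for x y
      using that ends_T ends_psi by (force simp: adjacency_def edges_G)+
    have "(\<phi> l, l) \<in> adjacency G"
      using l ends_mu by (force simp: adjacency_def edges_G insert_commute)
    moreover have "(\<phi> w, \<phi> l) \<in> (adjacency G)\<^sup>*" if "w \<in> verts T" for w
      using conn[OF that] by (induction rule: rtrancl_induct) (auto intro: rtrancl_into_rtrancl adj)
    moreover have "(w, l) \<in> (adjacency G)\<^sup>*" if "w \<in> verts T" for w
      using conn[OF that] by (induction rule: rtrancl_induct) (auto intro: rtrancl_into_rtrancl adj)
    ultimately show ?thesis using \<open>u \<in> verts G\<close> by (auto simp: verts_G intro: rtrancl_into_rtrancl)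
  qed
  moreover have "verts G \<noteq> {}" using l leaves_subset by (auto simp: verts_G)
  ultimately show ?thesis
    unfolding connected_graph_def by (meson rtrancl_trans adjacency_rtrancl_sym)
qed

lemma bipartite_G: "bipartite_graph G"
proof -
  obtain c where c: "\<And>e u v. e \<in> edges T \<Longrightarrow> ends T e = {u, v} \<Longrightarrow> c u \<noteq> (c v :: bool)"
    using tree_two_colouring[OF tree] by metis
  \<comment> \<open>The colours are swapped in the copy, so that a new edge, which joins a leaf to
    its own copy, also runs between the two classes.\<close>
  define A where "A = {v \<in> verts T. c v} \<union> \<phi> ` {v \<in> verts T. \<not> c v}"
  define B where "B = {v \<in> verts T. \<not> c v} \<union> \<phi> ` {v \<in> verts T. c v}"
  have "\<exists>a\<in>A. \<exists>b\<in>B. ends G e = {a, b}" if e: "e \<in> edges G" for e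
  proof -
    have orient: "\<exists>a b. a \<in> verts T \<and> b \<in> verts T \<and> c a \<and> \<not> c b \<and> ends T f = {a, b}"
      if f: "f \<in> edges T" for f
    proof -
      obtain u v where uv: "ends T f = {u, v}" using card_ends[OF f] by (auto simp: card_2_iff)
      then show ?thesis using c[OF f uv] ends_subset[OF f] by (cases "c u") (auto simp: insert_commute)
    qed
    consider "e \<in> edges T" | f where "f \<in> edges T" "e = \<psi> f" | l where "l \<in> leaves T" "e = \<mu> l"
      using e edges_G by blast
    then show ?thesis
    proof cases
      case 1
      then show ?thesis using orient[of e] by (auto simp: ends_T A_def B_def)
    next
      case (2 f)
      from orient[OF 2(1)] obtain a b where "a \<in> verts T" "b \<in> verts T" "c a" "\<not> c b"
        "ends T f = {a, b}" by blast
      with 2 have "\<phi> b \<in> A" "\<phi> a \<in> B" "ends G e = {\<phi> b, \<phi> a}"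
        by (auto simp: ends_psi A_def B_def insert_commute)
      then show ?thesis by blast
    next
      case (3 l)
      then have "l \<in> verts T" using leaves_subset by blast
      show ?thesis
      proof (cases "c l")
        case True
        then have "l \<in> A" "\<phi> l \<in> B" using \<open>l \<in> verts T\<close> by (auto simp: A_def B_def)
        then show ?thesis using 3 ends_mu by blast
      next
        case False
        then have "\<phi> l \<in> A" "l \<in> B" using \<open>l \<in> verts T\<close> by (auto simp: A_def B_def)
        then show ?thesis using 3 ends_mu by (metis insert_commute)
      qed
    qed
  qed
  moreover have "A \<union> B = verts G" "A \<inter> B = {}"
    using phi_notin phi_eq by (auto simp: A_def B_def verts_G)
  ultimately show ?thesis unfolding bipartite_graph_def by blast
qed

section \<open>Every edge of \<open>G\<close> lies in a perfect matching\<close>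

lemma perfect_matching_lift:
  assumes N: "nonleaf_matching T N"
  defines "K \<equiv> {l \<in> leaves T. \<forall>e\<in>N. l \<notin> ends T e}"
  shows "perfect_matching G (N \<union> \<psi> ` N \<union> \<mu> ` K)"
proof -
  let ?M = "N \<union> \<psi> ` N \<union> \<mu> ` K"
  have N_sub: "N \<subseteq> edges T" and K_sub: "K \<subseteq> leaves T"
    and uniq: "\<And>v e f. v \<in> verts T \<Longrightarrow> e \<in> N \<Longrightarrow> f \<in> N \<Longrightarrow> v \<in> ends T e \<Longrightarrow> v \<in> ends T f \<Longrightarrow> e = f"
    and cover: "\<And>v. v \<in> verts T \<Longrightarrow> v \<notin> K \<Longrightarrow> \<exists>e\<in>N. v \<in> ends T e"
    using N by (auto simp: nonleaf_matching_def K_def)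
  have "\<exists>!f. f \<in> ?M \<and> v \<in> ends G f" if v: "v \<in> verts T" for v
  proof -
    \<comment> \<open>At \<open>v\<close> only the edges of \<open>N\<close> and possibly
      \<open>\<mu> v\<close> count. The latter is present exactly when \<open>v\<close> is a leaf
      exposed by \<open>N\<close>, so the two sources never compete.\<close>
    have iff: "f \<in> ?M \<and> v \<in> ends G f \<longleftrightarrow> f \<in> N \<and> v \<in> ends T f \<or> v \<in> K \<and> f = \<mu> v" for f
      using incident_vert[OF v] N_sub K_sub by blast
    show ?thesis
    proof (cases "v \<in> K")
      case True
      then show ?thesis unfolding iff by (auto simp: K_def)
    next
      case False
      then show ?thesis unfolding iff using cover[OF v] uniq[OF v] by blast
    qed
  qed
  moreover have "\<exists>!f. f \<in> ?M \<and> \<phi> v \<in> ends G f" if v: "v \<in> verts T" for v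
  proof -
    have iff: "f \<in> ?M \<and> \<phi> v \<in> ends G f \<longleftrightarrow> (\<exists>e\<in>N. f = \<psi> e \<and> v \<in> ends T e) \<or> v \<in> K \<and> f = \<mu> v" for f
      using incident_copy[OF v] N_sub K_sub by blast
    show ?thesis
    proof (cases "v \<in> K")
      case True
      then show ?thesis unfolding iff by (auto simp: K_def)
    next
      case False
      then show ?thesis unfolding iff using cover[OF v] uniq[OF v] by blast
    qed
  qed
  moreover have "?M \<subseteq> edges G" using N_sub K_sub edges_G by blast
  ultimately show ?thesis unfolding perfect_matching_def verts_G ball_Un ball_simps by (intro conjI ballI)
qed

lemma matching_covered_G: "matching_covered G"
proof -
  have "\<exists>M. perfect_matching G M \<and> e \<in> M \<and> \<psi> e \<in> M" if e: "e \<in> edges T" for e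
  proof -
    \<comment> \<open>Rooting at either end of \<open>e\<close>, with the root not declared matched,
      puts \<open>e\<close> into \<open>N\<close>; the lifted matching then contains
      \<open>e\<close> and its copy.\<close>
    obtain r where "r \<in> ends T e" using card_ends[OF e] by fastforce
    then obtain N where "nonleaf_matching T N" "e \<in> N"
      using tree_nonleaf_matching[OF tree card_T e, of r False] by auto
    then show ?thesis using perfect_matching_lift by blast
  qed
  moreover have "\<exists>M. perfect_matching G M \<and> \<mu> l \<in> M" if l: "l \<in> leaves T" for l
  proof -
    have "{e \<in> edges T. l \<in> ends T e} \<noteq> {}"
      using l by (force simp: leaves_def degree_def)
    \<comment> \<open>Rooting at \<open>l\<close> itself and declaring it matched leaves
      \<open>l\<close> exposed by \<open>N\<close>, so the lifted matching uses
      \<open>\<mu> l\<close>.\<close>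
    then obtain e where "e \<in> edges T" "l \<in> ends T e" by blast
    then obtain N where "nonleaf_matching T N" "\<forall>e\<in>N. l \<notin> ends T e"
      using tree_nonleaf_matching[OF tree card_T, of e l True] l by auto
    then show ?thesis using perfect_matching_lift l by blast
  qed
  ultimately have "\<forall>e\<in>edges G. \<exists>M. perfect_matching G M \<and> e \<in> M"
    unfolding edges_G by blast
  then show ?thesis
    using is_graph_G connected_G card_T by (simp add: matching_covered_def card_verts_G)
qed

section \<open>Forced edges and minimality\<close>

text \<open>Removing \<open>e\<close> splits \<open>T\<close> into two parts; one part together with its copy is a vertex set of
  even size whose cut in \<open>G\<close> is \<open>{e, \<psi> e}\<close>.\<close>

lemma perfect_matching_psi:
  assumes M: "perfect_matching G M" and e: "e \<in> edges T"
  shows "e \<in> M \<longleftrightarrow> \<psi> e \<in> M"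
proof -
  obtain u v where uv: "ends T e = {u, v}" "u \<noteq> v" using card_ends[OF e] by (auto simp: card_2_iff)
  let ?R = "(adjacency (delete_edge T e))\<^sup>*"
  \<comment> \<open>The component of \<open>u\<close> in \<open>T\<close> without \<open>e\<close>;
    it misses \<open>v\<close> because \<open>e\<close> is a bridge.\<close>
  define A where "A = {w \<in> verts T. (u, w) \<in> ?R}"
  define X where "X = A \<union> \<phi> ` A"
  have A_sub: "A \<subseteq> verts T" by (auto simp: A_def)
  have A_iff: "x \<in> A \<longleftrightarrow> y \<in> A" if "f \<in> edges T" "f \<noteq> e" "ends T f = {x, y}" for f x y
  proof -
    have "(x, y) \<in> adjacency (delete_edge T e)" using that by (auto simp: adjacency_def)
    moreover from this have "(y, x) \<in> adjacency (delete_edge T e)" by (rule adjacency_sym)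
    moreover have "x \<in> verts T" "y \<in> verts T" using ends_subset[OF that(1)] that(3) by auto
    ultimately show ?thesis by (auto simp: A_def intro: rtrancl_into_rtrancl)
  qed
  have u: "u \<in> A" "v \<notin> A"
    using tree_edge_is_bridge[OF tree e uv(1)] ends_subset[OF e] uv by (auto simp: A_def)
  have X_vert: "x \<in> X \<longleftrightarrow> x \<in> A" "\<phi> x \<in> X \<longleftrightarrow> x \<in> A" if "x \<in> verts T" for x
    using that A_sub phi_notin phi_eq by (auto simp: X_def)
  have pair: "odd (card ({x, y} \<inter> X)) \<longleftrightarrow> (x \<in> X) \<noteq> (y \<in> X)" if "x \<noteq> y" for x y
    using that by (cases "x \<in> X"; cases "y \<in> X") auto
  \<comment> \<open>\<open>X\<close> contains a vertex of \<open>T\<close> exactly when it contains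
    its copy, so no new edge crosses. An edge of \<open>T\<close> or of the copy crosses only if it
    is \<open>e\<close> or \<open>\<psi> e\<close>, since all other edges of \<open>T\<close> stay
    within one component.\<close>
  have cut: "odd (card (ends G f \<inter> X)) \<longleftrightarrow> f = e \<or> f = \<psi> e" if f: "f \<in> edges G" for f
  proof -
    consider "f \<in> edges T" | g where "g \<in> edges T" "f = \<psi> g" | l where "l \<in> leaves T" "f = \<mu> l"
      using f edges_G by blast
    then show ?thesis
    proof cases
      case 1
      obtain x y where xy: "ends T f = {x, y}" "x \<noteq> y"
        using card_ends[OF 1] by (auto simp: card_2_iff)
      then have V: "x \<in> verts T" "y \<in> verts T" using ends_subset[OF 1] by auto
      have "odd (card (ends G f \<inter> X)) \<longleftrightarrow> (x \<in> A) \<noteq> (y \<in> A)"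
        using ends_T[OF 1] xy pair[OF xy(2)] X_vert V by simp
      also have "\<dots> \<longleftrightarrow> f = e" using A_iff[OF 1 _ xy(1)] u uv xy by (auto simp: doubleton_eq_iff)
      finally show ?thesis using psi_notin[OF e] 1 by auto
    next
      case (2 g)
      obtain x y where xy: "ends T g = {x, y}" "x \<noteq> y"
        using card_ends[OF 2(1)] by (auto simp: card_2_iff)
      then have V: "x \<in> verts T" "y \<in> verts T" using ends_subset[OF 2(1)] by auto
      then have "odd (card (ends G f \<inter> X)) \<longleftrightarrow> (x \<in> A) \<noteq> (y \<in> A)"
        using ends_psi[OF 2(1)] 2(2) xy pair[of "\<phi> x" "\<phi> y"] X_vert phi_eq by simp
      also have "\<dots> \<longleftrightarrow> g = e" using A_iff[OF 2(1) _ xy(1)] u uv xy by (auto simp: doubleton_eq_iff)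
      also have "\<dots> \<longleftrightarrow> \<psi> g = \<psi> e" using inj_on_eq_iff[OF inj_psi 2(1) e] by simp
      finally show ?thesis using psi_notin[OF 2(1)] 2(2) e by auto
    next
      case (3 l)
      then have V: "l \<in> verts T" using leaves_subset by blast
      then have "l \<noteq> \<phi> l" using phi_notin by metis
      then have "even (card (ends G f \<inter> X))" using 3 ends_mu pair[of l "\<phi> l"] X_vert[OF V] by simp
      then show ?thesis using mu_notin[OF 3(1)] 3(2) e by auto
    qed
  qed
  \<comment> \<open>\<open>X\<close> has \<open>2 * card A\<close> elements. By parity
    \<open>M\<close> contains an even number of the two cut edges, hence both or neither.\<close>
  have "card (\<phi> ` A) = card A" using inj_on_subset[OF inj_phi A_sub] by (rule card_image)
  moreover have "card X = card A + card (\<phi> ` A)"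
    unfolding X_def using finite_subset[OF A_sub finite_T(1)] A_sub phi_notin
    by (intro card_Un_disjoint) auto
  moreover have "X \<subseteq> verts G" using A_sub by (auto simp: X_def verts_G)
  ultimately have "even (card {f \<in> M. odd (card (ends G f \<inter> X))})"
    using perfect_matching_parity[OF is_graph_G M, of X] by simp
  moreover have "{f \<in> M. odd (card (ends G f \<inter> X))} = M \<inter> {e, \<psi> e}"
    using cut M by (auto simp: perfect_matching_def)
  moreover have "e \<noteq> \<psi> e" using psi_notin[OF e] e by metis
  ultimately show ?thesis by (cases "e \<in> M"; cases "\<psi> e \<in> M") auto
qed

text \<open>A leaf \<open>l\<close> has degree two in \<open>G\<close>, so a perfect matching using another edge at its
  neighbour in \<open>T\<close> must contain \<open>\<mu> l\<close>.\<close>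

lemma leaf_edge_forced:
  assumes l: "l \<in> leaves T"
  obtains f where "f \<in> edges G" "f \<noteq> \<mu> l" "\<And>M. perfect_matching G M \<Longrightarrow> f \<in> M \<Longrightarrow> \<mu> l \<in> M"
proof -
  have lV: "l \<in> verts T" using l leaves_subset by blast
  obtain e where inc: "{e \<in> edges T. l \<in> ends T e} = {e}"
    using l by (auto simp: leaves_def degree_def card_1_singleton_iff)
  then have e: "e \<in> edges T" "l \<in> ends T e" by blast+
  then obtain u where u: "ends T e = {l, u}" "u \<noteq> l"
    using card_ends[OF e(1)] by (metis card_2_iff insertE insert_commute singletonD)
  have uV: "u \<in> verts T" using ends_subset[OF e(1)] u by auto
  \<comment> \<open>The forcing edge \<open>f\<close> is a second edge at the neighbour
    \<open>u\<close>. It exists even if \<open>u\<close> is itself a leaf of \<open>T\<close>, since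
    \<open>u\<close> then has the new edge \<open>\<mu> u\<close>.\<close>
  have "\<not> {f \<in> edges G. u \<in> ends G f} \<subseteq> {e}"
    using degree_G_ge_two[OF uV] card_mono[of "{e}" "{f \<in> edges G. u \<in> ends G f}"] by (auto simp: degree_def)
  then obtain f where f: "f \<in> edges G" "u \<in> ends G f" "f \<noteq> e" by blast
  show ?thesis
  proof
    show "f \<in> edges G" by fact
    show "f \<noteq> \<mu> l" using f(2) incident_vert(3)[OF uV l] u(2) by auto
    fix M assume M: "perfect_matching G M" "f \<in> M"
    have ex1: "\<exists>!g. g \<in> M \<and> v \<in> ends G g" if "v \<in> verts T" for v
      using M(1) that by (simp add: perfect_matching_def verts_G)
    have "u \<in> ends G e" using ends_T[OF e(1)] u by simp
    then have "e \<notin> M" using ex1[OF uV] M(2) f by blast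
    obtain g where g: "g \<in> M" "l \<in> ends G g" using ex1[OF lV] by blast
    then have "g \<in> edges G" using M(1) by (auto simp: perfect_matching_def)
    then have "g = e \<or> g = \<mu> l"
      using g(2) inc incident_vert[OF lV] by (auto simp: edges_G)
    then show "\<mu> l \<in> M" using g(1) \<open>e \<notin> M\<close> by auto
  qed
qed

lemma minimal_matching_covered_G: "minimal_matching_covered G"
proof -
  have "\<not> matching_covered (delete_edge G e)" if e: "e \<in> edges G" for e
  proof -
    consider "e \<in> edges T" | f where "f \<in> edges T" "e = \<psi> f" | l where "l \<in> leaves T" "e = \<mu> l"
      using e edges_G by blast
    then show ?thesis
    proof cases
      case 1
      show ?thesis
      proof (rule not_matching_covered_deleteI)
        show "\<psi> e \<in> edges G" "\<psi> e \<noteq> e" using 1 psi_notin[OF 1] by (auto simp: edges_G)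
      qed (use perfect_matching_psi 1 in blast)
    next
      case (2 f)
      show ?thesis
      proof (rule not_matching_covered_deleteI)
        show "f \<in> edges G" "f \<noteq> e" using 2 psi_notin[OF 2(1)] by (auto simp: edges_G)
      qed (use perfect_matching_psi 2 in blast)
    next
      case (3 l)
      obtain f where "f \<in> edges G" "f \<noteq> \<mu> l" "\<And>M. perfect_matching G M \<Longrightarrow> f \<in> M \<Longrightarrow> \<mu> l \<in> M"
        using leaf_edge_forced[OF 3(1)] by metis
      then show ?thesis unfolding 3(2) by (rule not_matching_covered_deleteI)
    qed
  qed
  then show ?thesis using matching_covered_G by (simp add: minimal_matching_covered_def)
qed

section \<open>Vertices of degree two and leaf counts\<close>

lemma card_degree_two_verts:
  assumes halin: "\<And>v. v \<in> verts T \<Longrightarrow> degree T v \<noteq> 2"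
  shows "card (degree_two_verts G) = 2 * card (leaves T)"
proof -
  \<comment> \<open>A leaf and its copy have degree 1 + 1 in \<open>G\<close>. Every other vertex
    keeps its degree in \<open>T\<close>, which is not two.\<close>
  have "degree_two_verts G = leaves T \<union> \<phi> ` leaves T"
    using degree_vert degree_copy halin leaves_subset
    by (auto simp: degree_two_verts_def verts_G leaves_def split: if_splits)
  moreover have "card (leaves T \<union> \<phi> ` leaves T) = card (leaves T) + card (\<phi> ` leaves T)"
    using finite_T leaves_subset phi_notin by (intro card_Un_disjoint) auto
  moreover have "card (\<phi> ` leaves T) = card (leaves T)"
    using inj_on_subset[OF inj_phi leaves_subset] by (rule card_image)
  ultimately show ?thesis by simp
qed

end

text \<open>With \<open>t\<close> vertices and \<open>l\<close> leaves, the handshake identity reads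
  \<open>3 * (t - l) + l = 2 * (t - 1)\<close>.\<close>

lemma cubic_tree_card_leaves:
  assumes T: "is_tree T" and cubic: "\<And>v. v \<in> verts T - leaves T \<Longrightarrow> degree T v = 3"
  shows "2 * card (leaves T) = card (verts T) + 2"
proof -
  have gr: "is_graph T" and fin: "finite (verts T)" using T by (auto simp: is_tree_def is_graph_def)
  have sub: "leaves T \<subseteq> verts T" by (auto simp: leaves_def)
  have "(\<Sum>v\<in>verts T. degree T v) = (\<Sum>v\<in>verts T - leaves T. degree T v) + (\<Sum>v\<in>leaves T. degree T v)"
    using sum.subset_diff[OF sub fin] .
  also have "(\<Sum>v\<in>verts T - leaves T. degree T v) = 3 * card (verts T - leaves T)"
    using cubic by simp
  also have "(\<Sum>v\<in>leaves T. degree T v) = card (leaves T)"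
    by (simp add: leaves_def)
  finally have "2 * card (edges T) = 3 * card (verts T - leaves T) + card (leaves T)"
    using handshake[OF gr] by simp
  moreover have "card (verts T) = card (verts T - leaves T) + card (leaves T)"
    using sub fin by (metis card_Diff_subset card_mono finite_subset le_add_diff_inverse2)
  ultimately show ?thesis using tree_card_edges[OF T] by linarith
qed

text \<open>The leaves are exactly the vertices other than the centre: the bound
  \<open>2 \<le> card L\<close> keeps the centre from being a leaf.\<close>

lemma star_card_leaves:
  assumes "is_star T"
  shows "card (verts T) = Suc (card (leaves T))"
proof -
  obtain c L where L: "finite L" "2 \<le> card L" "c \<notin> L" "verts T = insert c L"
    and bij: "bij_betw (ends T) (edges T) ((\<lambda>l. {c, l}) ` L)"
    using assms by (auto simp: is_star_def)
  \<comment> \<open>\<open>ends T\<close> is injective on the edges, so degrees can be counted on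
    the pairs \<open>{c, l}\<close> instead of the abstract edges.\<close>
  have deg: "degree T v = card {D \<in> (\<lambda>l. {c, l}) ` L. v \<in> D}" for v
  proof -
    have "ends T ` {e \<in> edges T. v \<in> ends T e} = {D \<in> (\<lambda>l. {c, l}) ` L. v \<in> D}"
      using bij unfolding bij_betw_def by blast
    moreover have "inj_on (ends T) {e \<in> edges T. v \<in> ends T e}"
      using bij by (auto simp: bij_betw_def inj_on_def)
    ultimately show ?thesis by (metis card_image degree_def)
  qed
  have "inj_on (\<lambda>l. {c, l}) L" by (auto simp: inj_on_def doubleton_eq_iff)
  moreover have "{D \<in> (\<lambda>l. {c, l}) ` L. c \<in> D} = (\<lambda>l. {c, l}) ` L" by auto
  ultimately have "degree T c = card L" by (simp add: deg card_image)
  moreover have "degree T l = 1" if "l \<in> L" for l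
  proof -
    have "{D \<in> (\<lambda>l. {c, l}) ` L. l \<in> D} = {{c, l}}" using that L(3) by auto
    then show ?thesis by (simp add: deg)
  qed
  ultimately have "leaves T = L" using L by (auto simp: leaves_def)
  then show ?thesis using L by simp
qed

theorem theorem1p8:
  fixes T G :: "('v, 'e) multigraph"
  assumes "halin_tree T"
    and "isomorphic_leaf_matching T G"
  shows "minimal_bipartite_matching_covered G \<and> two_vertex_extremal G \<and>
    (cubic_halin_tree T \<longrightarrow> two_vertex_n_extremal G) \<and>
    (is_star T \<longrightarrow> edge_extremal G)"
proof -
  obtain T' \<phi> \<psi> \<mu> where "leaf_matching T T' G \<phi> \<psi> \<mu>"
    using assms(2) unfolding isomorphic_leaf_matching_def Ball_def
    by (elim conjE exE) (rule that, unfold leaf_matching_def, intro conjI, assumption+)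
  then interpret leaf_matching T T' G \<phi> \<psi> \<mu> .
  have minimal: "minimal_bipartite_matching_covered G"
    using bipartite_G minimal_matching_covered_G
    by (simp add: minimal_bipartite_matching_covered_def)
  have V2: "card (degree_two_verts G) = 2 * card (leaves T)"
    using assms(1) by (intro card_degree_two_verts) (simp add: halin_tree_def)
  \<comment> \<open>Let \<open>T\<close> have \<open>t\<close> vertices and \<open>l\<close> leaves.
    Then \<open>n = 2 * t\<close> and \<open>m = 2 * (t - 1) + l\<close>, so
    \<open>m - n + 2 = l\<close>, while there are \<open>2 * l\<close> vertices of degree
    two.\<close>
  note counts = V2 card_verts_G card_edges_G tree_card_edges[OF tree]
  have "two_vertex_extremal G"
    using minimal counts by (simp add: two_vertex_extremal_def)
  moreover have "two_vertex_n_extremal G" if "cubic_halin_tree T"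
  proof -
    have "2 * card (leaves T) = card (verts T) + 2"
      using that tree by (intro cubic_tree_card_leaves) (auto simp: cubic_halin_tree_def)
    \<comment> \<open>Here \<open>n / 2 + 2 = t + 2 = 2 * l\<close>.\<close>
    then show ?thesis using minimal counts by (simp add: two_vertex_n_extremal_def)
  qed
  \<comment> \<open>For a star \<open>t = l + 1\<close>, so \<open>m\<close> and
    \<open>(3 * n - 6) / 2\<close> are both equal to \<open>3 * l\<close>.\<close>
  moreover have "edge_extremal G" if "is_star T"
    using minimal counts star_card_leaves[OF that] by (simp add: edge_extremal_def)
  ultimately show ?thesis using minimal by blast
qed

end
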